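(* Let $(L,[-,-,-]_L)$ and $(H,[-,-,-]_H)$ be 3-Lie algebras over a field $\mathbb{K}$ of characteristic $0$, let $\rho:\wedge^2L\to\mathrm{End}(H)$ be a coherent action of $L$ on $H$, and let $\Lambda:H\to L$ be a nonabelian embedding tensor on $L$ with respect to this coherent action. Define $$\{h_1,h_2,h_3\}_\Lambda:=\rho(\Lambda h_1,\Lambda h_2)h_3,\qquad h_1,h_2,h_3\in H.$$ Then $(H,[-,-,-]_H,\{-,-,-\}_\Lambda)$ is a 3-Leibniz-Lie algebra.
   Context: All vector spaces are over a field $\mathbb{K}$ of characteristic $0$. A 3-Lie algebra $(L,[-,-,-]_L)$ is a vector space $L$ with a skew-symmetric trilinear map $[-,-,-]_L:\wedge^3L\to L$ such that for all $l_i\in L$ $$[l_1,l_2,[l_3,l_4,l_5]_L]_L=[[l_1,l_2,l_3]_L,l_4,l_5]_L+[l_3,[l_1,l_2,l_4]_L,l_5]_L+[l_3,l_4,[l_1,l_2,l_5]_L]_L.$$ A coherent action of a 3-Lie algebra $L$ on a 3-Lie algebra $H$ is a linear map $\rho:\wedge^2L\to\mathrm{End}(H)$ such that for all $l_i\in L$, $h_i\in H$: $$\rho([l_1,l_2,l_3]_L,l_4)=\rho(l_2,l_3)\rho(l_1,l_4)+\rho(l_3,l_1)\rho(l_2,l_4)+\rho(l_1,l_2)\rho(l_3,l_4),$$ $$\rho(l_1,l_2)\rho(l_3,l_4)=\rho(l_3,l_4)\rho(l_1,l_2)+\rho([l_1,l_2,l_3]_L,l_4)+\rho(l_3,[l_1,l_2,l_4]_L),$$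 $$\rho(l_1,l_2)[h_1,h_2,h_3]_H=[\rho(l_1,l_2)h_1,h_2,h_3]_H+[h_1,\rho(l_1,l_2)h_2,h_3]_H+[h_1,h_2,\rho(l_1,l_2)h_3]_H,$$ $$[\rho(l_1,l_2)h_1,h_2,h_3]_H=0.$$ A nonabelian embedding tensor on $L$ with respect to the coherent action is a linear map $\Lambda:H\to L$ with $[\Lambda h_1,\Lambda h_2,\Lambda h_3]_L=\Lambda(\rho(\Lambda h_1,\Lambda h_2)h_3+[h_1,h_2,h_3]_H)$ for all $h_i\in H$. A 3-Leibniz-Lie algebra $(H,[-,-,-]_H,\{-,-,-\}_H)$ consists of a 3-Lie algebra $(H,[-,-,-]_H)$ and a trilinear product $\{-,-,-\}_H:H\otimes H\otimes H\to H$ such that for all $h_1,\dots,h_5\in H$ $$\{h_1,h_2,\{h_3,h_4,h_5\}_H\}_H=\{\{h_1,h_2,h_3\}_H,h_4,h_5\}_H+\{h_3,\{h_1,h_2,h_4\}_H,h_5\}_H+\{h_3,h_4,\{h_1,h_2,h_5\}_H\}_H+\{[h_1,h_2,h_3]_H,h_4,h_5\}_H+\{h_3,[h_1,h_2,h_4]_H,h_5\}_H,$$ $$\{h_1,h_2,[h_3,h_4,h_5]_H\}_H=[\{h_1,h_2,h_3\}_H,h_4,h_5]_H=0.$$ *)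

theory Defs
  imports Complex_Main
begin

text \<open>A map on \<open>\<and>\<^sup>n V\<close> is represented by a curried multilinear skew-symmetric map, and
  an element of \<open>End(H)\<close> by a linear function on the type of \<open>H\<close>. Skew-symmetry is stated
  on adjacent transpositions, which generate the symmetric group; in characteristic \<open>0\<close>
  skew-symmetric and alternating maps coincide.\<close>

definition trilinear_product ::
  "('k::field \<Rightarrow> 'v::ab_group_add \<Rightarrow> 'v) \<Rightarrow> ('v \<Rightarrow> 'v \<Rightarrow> 'v \<Rightarrow> 'v) \<Rightarrow> bool" where
  "trilinear_product s f \<longleftrightarrow>
     (\<forall>y z. Vector_Spaces.linear s s (\<lambda>x. f x y z)) \<and>
     (\<forall>x z. Vector_Spaces.linear s s (\<lambda>y. f x y z)) \<and>
     (\<forall>x y. Vector_Spaces.linear s s (\<lambda>z. f x y z))"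

locale three_lie_algebra = vector_space s
  for s :: "'k::field_char_0 \<Rightarrow> 'v::ab_group_add \<Rightarrow> 'v" +
  fixes br :: "'v \<Rightarrow> 'v \<Rightarrow> 'v \<Rightarrow> 'v"
  assumes trilinear_br: "trilinear_product s br"
    and skew_br_12: "br y x z = - br x y z"
    and skew_br_23: "br x z y = - br x y z"
    and fundamental_identity:
      "br l1 l2 (br l3 l4 l5)
       = br (br l1 l2 l3) l4 l5 + br l3 (br l1 l2 l4) l5 + br l3 l4 (br l1 l2 l5)"

text \<open>Linearity of \<open>\<rho>\<close> in its first two arguments is with respect to the pointwise
  vector space structure of \<open>End(H)\<close>.\<close>

locale coherent_action =
  L: three_lie_algebra sL brL + H: three_lie_algebra sH brH
  for sL :: "'k::field_char_0 \<Rightarrow> 'l::ab_group_add \<Rightarrow> 'l"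
    and brL :: "'l \<Rightarrow> 'l \<Rightarrow> 'l \<Rightarrow> 'l"
    and sH :: "'k \<Rightarrow> 'h::ab_group_add \<Rightarrow> 'h"
    and brH :: "'h \<Rightarrow> 'h \<Rightarrow> 'h \<Rightarrow> 'h" +
  fixes \<rho> :: "'l \<Rightarrow> 'l \<Rightarrow> 'h \<Rightarrow> 'h"
  assumes endo_\<rho>: "Vector_Spaces.linear sH sH (\<rho> l1 l2)"
    and linear_\<rho>_1: "Vector_Spaces.linear sL sH (\<lambda>l1. \<rho> l1 l2 h)"
    and linear_\<rho>_2: "Vector_Spaces.linear sL sH (\<lambda>l2. \<rho> l1 l2 h)"
    and skew_\<rho>: "\<rho> l2 l1 h = - \<rho> l1 l2 h"
    and \<rho>_bracket:
      "\<rho> (brL l1 l2 l3) l4 h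
       = \<rho> l2 l3 (\<rho> l1 l4 h) + \<rho> l3 l1 (\<rho> l2 l4 h) + \<rho> l1 l2 (\<rho> l3 l4 h)"
    and \<rho>_commute:
      "\<rho> l1 l2 (\<rho> l3 l4 h)
       = \<rho> l3 l4 (\<rho> l1 l2 h) + \<rho> (brL l1 l2 l3) l4 h + \<rho> l3 (brL l1 l2 l4) h"
    and \<rho>_derivation:
      "\<rho> l1 l2 (brH h1 h2 h3)
       = brH (\<rho> l1 l2 h1) h2 h3 + brH h1 (\<rho> l1 l2 h2) h3 + brH h1 h2 (\<rho> l1 l2 h3)"
    and \<rho>_coherent: "brH (\<rho> l1 l2 h1) h2 h3 = 0"

locale nonabelian_embedding_tensor =
  coherent_action sL brL sH brH \<rho>
  for sL :: "'k::field_char_0 \<Rightarrow> 'l::ab_group_add \<Rightarrow> 'l"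
    and brL :: "'l \<Rightarrow> 'l \<Rightarrow> 'l \<Rightarrow> 'l"
    and sH :: "'k \<Rightarrow> 'h::ab_group_add \<Rightarrow> 'h"
    and brH :: "'h \<Rightarrow> 'h \<Rightarrow> 'h \<Rightarrow> 'h"
    and \<rho> :: "'l \<Rightarrow> 'l \<Rightarrow> 'h \<Rightarrow> 'h" +
  fixes \<Lambda> :: "'h \<Rightarrow> 'l"
  assumes linear_\<Lambda>: "Vector_Spaces.linear sH sL \<Lambda>"
    and embedding_tensor:
      "brL (\<Lambda> h1) (\<Lambda> h2) (\<Lambda> h3) = \<Lambda> (\<rho> (\<Lambda> h1) (\<Lambda> h2) h3 + brH h1 h2 h3)"

locale three_leibniz_lie_algebra = three_lie_algebra s br
  for s :: "'k::field_char_0 \<Rightarrow> 'v::ab_group_add \<Rightarrow> 'v"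
    and br :: "'v \<Rightarrow> 'v \<Rightarrow> 'v \<Rightarrow> 'v" +
  fixes cb :: "'v \<Rightarrow> 'v \<Rightarrow> 'v \<Rightarrow> 'v"
  assumes trilinear_cb: "trilinear_product s cb"
    and leibniz_lie_identity:
      "cb h1 h2 (cb h3 h4 h5)
       = cb (cb h1 h2 h3) h4 h5 + cb h3 (cb h1 h2 h4) h5 + cb h3 h4 (cb h1 h2 h5)
         + cb (br h1 h2 h3) h4 h5 + cb h3 (br h1 h2 h4) h5"
    and cb_br: "cb h1 h2 (br h3 h4 h5) = 0"
    and br_cb: "br (cb h1 h2 h3) h4 h5 = 0"

definition induced_product ::
  "('l \<Rightarrow> 'l \<Rightarrow> 'h \<Rightarrow> 'h) \<Rightarrow> ('h \<Rightarrow> 'l) \<Rightarrow> 'h \<Rightarrow> 'h \<Rightarrow> 'h \<Rightarrow> 'h" where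
  "induced_product \<rho> \<Lambda> h1 h2 h3 = \<rho> (\<Lambda> h1) (\<Lambda> h2) h3"

end

theory Submission imports Defs begin

text \<open>Evaluated at images of \<open>\<Lambda>\<close>, the commutation rule
  \<open>\<rho>_commute\<close> is already the Leibniz-type identity, except that its correction
  terms contain brackets of L. By \<open>embedding_tensor\<close> each such bracket is
  \<open>\<Lambda>\<close> of a sum of a brace and a bracket of H; additivity splits these two
  corrections into the four required terms. The two vanishing laws come from coherence: the bracket
  of H is zero whenever one entry is a value of the action.\<close>

theorem theorem3p5:
  fixes sL :: "'k::field_char_0 \<Rightarrow> 'l::ab_group_add \<Rightarrow> 'l"
    and brL :: "'l \<Rightarrow> 'l \<Rightarrow> 'l \<Rightarrow> 'l"
    and sH :: "'k \<Rightarrow> 'h::ab_group_add \<Rightarrow> 'h"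
    and brH :: "'h \<Rightarrow> 'h \<Rightarrow> 'h \<Rightarrow> 'h"
    and \<rho> :: "'l \<Rightarrow> 'l \<Rightarrow> 'h \<Rightarrow> 'h"
    and \<Lambda> :: "'h \<Rightarrow> 'l"
  assumes "three_lie_algebra sL brL"
    and "three_lie_algebra sH brH"
    and "coherent_action sL brL sH brH \<rho>"
    and "nonabelian_embedding_tensor sL brL sH brH \<rho> \<Lambda>"
  shows "three_leibniz_lie_algebra sH brH (induced_product \<rho> \<Lambda>)"
proof -
  interpret nonabelian_embedding_tensor sL brL sH brH \<rho> \<Lambda> by fact
  interpret \<Lambda>: Vector_Spaces.linear sH sL \<Lambda> by (rule linear_\<Lambda>)
  have \<rho>_add_1: "\<rho> (x + y) l h = \<rho> x l h + \<rho> y l h" for x y l h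
    using linear_\<rho>_1[of l h] by (simp add: Vector_Spaces.linear_iff)
  have \<rho>_add_2: "\<rho> l (x + y) h = \<rho> l x h + \<rho> l y h" for x y l h
    using linear_\<rho>_2[of l h] by (simp add: Vector_Spaces.linear_iff)
  \<comment> \<open>Skew-symmetry carries coherence from the first slot to the others, so that all
    three terms of \<open>\<rho>_derivation\<close> vanish.\<close>
  have coherent_2: "brH h1 (\<rho> l1 l2 h2) h3 = 0" for l1 l2 h1 h2 h3
    using H.skew_br_12[of h1 "\<rho> l1 l2 h2" h3] by (simp add: \<rho>_coherent)
  have coherent_3: "brH h1 h2 (\<rho> l1 l2 h3) = 0" for l1 l2 h1 h2 h3
    using H.skew_br_23[of h1 h2 "\<rho> l1 l2 h3"] by (simp add: coherent_2)
  show ?thesis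
  \<comment> \<open>The 3-Lie axioms of H are discharged by the interpretation; only those on the
    braces remain.\<close>
  proof (unfold_locales, unfold induced_product_def)
    show "trilinear_product sH (\<lambda>h1 h2 h3. \<rho> (\<Lambda> h1) (\<Lambda> h2) h3)"
      unfolding trilinear_product_def
      using Vector_Spaces.linear_compose[OF linear_\<Lambda> linear_\<rho>_1]
        Vector_Spaces.linear_compose[OF linear_\<Lambda> linear_\<rho>_2] endo_\<rho>
      by (simp add: o_def)
  next
    fix h1 h2 h3 h4 h5
    show "\<rho> (\<Lambda> h1) (\<Lambda> h2) (\<rho> (\<Lambda> h3) (\<Lambda> h4) h5) =
        \<rho> (\<Lambda> (\<rho> (\<Lambda> h1) (\<Lambda> h2) h3)) (\<Lambda> h4) h5 +
        \<rho> (\<Lambda> h3) (\<Lambda> (\<rho> (\<Lambda> h1) (\<Lambda> h2) h4)) h5 +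
        \<rho> (\<Lambda> h3) (\<Lambda> h4) (\<rho> (\<Lambda> h1) (\<Lambda> h2) h5) +
        \<rho> (\<Lambda> (brH h1 h2 h3)) (\<Lambda> h4) h5 +
        \<rho> (\<Lambda> h3) (\<Lambda> (brH h1 h2 h4)) h5"
      \<comment> \<open>\<open>\<rho>_commute\<close> is applied just once: its right side contains
        an instance of its left side, so it would loop as a rewrite rule.\<close>
      by (subst \<rho>_commute) (simp add: embedding_tensor \<Lambda>.add \<rho>_add_1 \<rho>_add_2 ac_simps)
    show "\<rho> (\<Lambda> h1) (\<Lambda> h2) (brH h3 h4 h5) = 0"
      by (simp add: \<rho>_derivation \<rho>_coherent coherent_2 coherent_3)
    show "brH (\<rho> (\<Lambda> h1) (\<Lambda> h2) h3) h4 h5 = 0"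
      by (rule \<rho>_coherent)
  qed
qed

end
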